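(* For all integers $n\ge 0$: (a) $p_{R,D}^{(3,3)}(4n+2)\equiv 0 \pmod 2$; (b) $p_{R,D}^{(2,5)}(4n+3)\equiv 0 \pmod 2$; (c) $\sum_{n=0}^\infty p_{R,D}^{(2,5)}(4n+1)\,q^n\equiv \prod_{m=1}^\infty(1-q^{5m}) \pmod 2$, meaning that the coefficients of $q^n$ on the two sides are congruent modulo $2$ for every $n$.
   Context: For integers $s,t\ge 2$, $p_{R,D}^{(s,t)}(n)$ denotes the number of partitions of $n$ in which no part is divisible by $s$ and no part appears $t$ or more times. *)

theory Defs
  imports
    "HOL-Analysis.Infinite_Products"
    "HOL-Computational_Algebra.Formal_Power_Series"
    "HOL-Library.Multiset"
    "HOL-Number_Theory.Cong"
begin

definition int_partitions :: "nat \<Rightarrow> nat multiset set" where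
  "int_partitions n = {P. 0 \<notin># P \<and> sum_mset P = n}"

definition p_RD :: "nat \<Rightarrow> nat \<Rightarrow> nat \<Rightarrow> nat" where
  "p_RD s t n =
    card {P \<in> int_partitions n. (\<forall>k \<in># P. \<not> s dvd k) \<and> (\<forall>k \<in># P. \<not> count P k \<ge> t)}"

end

theory Submission
  imports
    Defs
    "HOL-Library.Z2"
    "HOL-Computational_Algebra.Formal_Laurent_Series"
begin

text \<open>
  Over a domain of characteristic 2, write f_k for the product of 1 - q^(km) over m at least 1, so
  that f_k^2 = f_2k. The generating function of p_RD s t is G = f_s f_t / (f_1 f_st).

  The Jacobi triple product turns f_k, f_k^3 and f_1 f_5 into theta series, and splitting sums over
  the integers or the plane lattice into residue classes relates these theta series:
    f_1^3 = f_3 + q f_9^3,  f_1^3 f_3^3 = f_4^3 + q f_12^3,  f_1 f_5 = f_2^3 + q f_10^3.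

  For (s, t) = (3, 3) this gives q G f_4 f_36 = f_2 f_4 f_6 + f_4^3 + q f_12^3, where no exponent on
  the right is congruent to 3 modulo 4, which is (a). For (s, t) = (2, 5) it gives
  G f_20 = f_2^3 f_10 + q f_20^2, so the odd part of G is q f_20, which is (b) and (c).
\<close>

section \<open>Infinite products of formal power series\<close>

lemma fps_cutoff_mult_cong:
  assumes "fps_cutoff m f = fps_cutoff m f'" "fps_cutoff m g = fps_cutoff m g'"
  shows "fps_cutoff m (f * g :: 'a::semiring_0 fps) = fps_cutoff m (f' * g')"
  using assms by (auto simp: fps_cutoff_eq_fps_cutoff_iff fps_mult_nth intro!: sum.cong)

lemma fps_cutoff_prod_cong:
  fixes f g :: "'b \<Rightarrow> 'a::comm_semiring_1 fps"
  assumes "\<And>i. i \<in> I \<Longrightarrow> fps_cutoff m (f i) = fps_cutoff m (g i)"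
  shows "fps_cutoff m (\<Prod>i\<in>I. f i) = fps_cutoff m (\<Prod>i\<in>I. g i)"
  using assms by (induction I rule: infinite_finite_induct) (auto intro: fps_cutoff_mult_cong)

lemma fps_eq_if_cutoffs_eq:
  assumes "\<And>m. fps_cutoff m f = fps_cutoff m g"
  shows "f = g"
  using assms by (metis fps_cutoff_eq_fps_cutoff_iff fps_ext lessI)

lemma fps_cutoff_X_power_mult_cong:
  fixes f g :: "'a::semiring_1 fps"
  assumes "fps_cutoff (m - k) f = fps_cutoff (m - k) g"
  shows "fps_cutoff m (f * fps_X ^ k) = fps_cutoff m (g * fps_X ^ k)"
  using assms by (auto simp: fps_cutoff_eq_fps_cutoff_iff fps_X_power_mult_right_nth)

lemma fps_cutoff_sum_cong:
  fixes f g :: "'b \<Rightarrow> 'a::comm_monoid_add fps"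
  assumes "\<And>i. i \<in> I \<Longrightarrow> fps_cutoff m (f i) = fps_cutoff m (g i)"
  shows "fps_cutoff m (\<Sum>i\<in>I. f i) = fps_cutoff m (\<Sum>i\<in>I. g i)"
  using assms by (simp add: fps_cutoff_eq_fps_cutoff_iff fps_sum_nth)

text \<open>Stronger than convergence: the first m factors alone determine the product modulo q^m.\<close>
definition fps_multipliable :: "(nat \<Rightarrow> 'a::comm_ring_1 fps) \<Rightarrow> bool" where
  "fps_multipliable g \<longleftrightarrow> (\<forall>i. fps_cutoff (Suc i) (g i) = fps_cutoff (Suc i) 1)"

lemma fps_multipliableD:
  "fps_multipliable g \<Longrightarrow> m \<le> Suc i \<Longrightarrow> fps_cutoff m (g i) = fps_cutoff m 1"
  by (auto simp: fps_multipliable_def fps_cutoff_eq_fps_cutoff_iff)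

lemma fps_multipliable_mult:
  assumes "fps_multipliable f" "fps_multipliable g"
  shows "fps_multipliable (\<lambda>i. f i * g i)"
  using fps_cutoff_mult_cong[OF fps_multipliableD[OF assms(1) order_refl]
      fps_multipliableD[OF assms(2) order_refl]]
  by (simp add: fps_multipliable_def)

lemma fps_multipliable_prod:
  assumes "\<And>r. r \<in> I \<Longrightarrow> fps_multipliable (f r)"
  shows "fps_multipliable (\<lambda>i. \<Prod>r\<in>I. f r i)"
  using assms
proof (induction I rule: infinite_finite_induct)
  case (insert r I)
  thus ?case by (simp add: fps_multipliable_mult)
qed (simp_all add: fps_multipliable_def)

lemma fps_multipliable_comp:
  assumes "fps_multipliable g" "\<And>i. i \<le> h i"
  shows "fps_multipliable (\<lambda>i. g (h i))"
  using assms by (auto simp: fps_multipliable_def fps_cutoff_eq_fps_cutoff_iff less_le_trans)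

lemma fps_multipliable_one_minus_X_power:
  assumes "a > 0" "d > 0"
  shows "fps_multipliable (\<lambda>i. 1 - fps_const c * fps_X ^ (a + d * i))"
proof -
  have "i < a + d * i" for i
    using assms by (metis add_less_le_mono add_0 mult_le_mono1 nat_mult_1 Suc_leI One_nat_def)
  hence "k \<noteq> a + d * i" if "k \<le> i" for k i
    using that by (metis not_le)
  thus ?thesis
    by (simp add: fps_multipliable_def fps_cutoff_eq_fps_cutoff_iff)
qed

lemma fps_cutoff_prod_lessThan:
  assumes "fps_multipliable g" "m \<le> N"
  shows "fps_cutoff m (\<Prod>i<N. g i) = fps_cutoff m (\<Prod>i<m. g i)"
proof -
  have "(\<Prod>i<N. g i) = (\<Prod>i<m. g i) * (\<Prod>i\<in>{m..<N}. g i)"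
    using prod.atLeastLessThan_concat[of 0 m N g] assms(2) by (simp add: atLeast0LessThan)
  moreover have "fps_cutoff m (\<Prod>i\<in>{m..<N}. g i) = fps_cutoff m (\<Prod>i\<in>{m..<N}. 1)"
    by (intro fps_cutoff_prod_cong fps_multipliableD[OF assms(1)]) simp
  ultimately show ?thesis
    using fps_cutoff_mult_cong[OF refl, of m "\<Prod>i\<in>{m..<N}. g i" 1] by simp
qed

lemma fps_multipliable_has_prod:
  assumes "fps_multipliable (g :: nat \<Rightarrow> 'a::idom fps)"
  shows "g has_prod Abs_fps (\<lambda>n. fps_nth (\<Prod>i<Suc n. g i) n)"
proof -
  define P where "P = Abs_fps (\<lambda>n. fps_nth (\<Prod>i<Suc n. g i) n)"
  have "eventually (\<lambda>k. fps_nth (\<Prod>i\<le>k. g i) n = fps_nth P n) sequentially" for n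
    using eventually_ge_at_top[of n]
  proof eventually_elim
    case (elim k)
    thus ?case
      using fps_cutoff_prod_lessThan[OF assms, of "Suc n" "Suc k"]
      by (simp add: P_def fps_cutoff_eq_fps_cutoff_iff flip: lessThan_Suc_atMost)
  qed
  hence "(\<lambda>k. \<Prod>i\<le>k. g i) \<longlonglongrightarrow> P"
    by (rule tendsto_fpsI)
  moreover have "fps_nth P 0 = 1"
    using fps_multipliableD[OF assms, of 1 0] by (simp add: P_def fps_cutoff_eq_fps_cutoff_iff)
  hence "P \<noteq> 0" by auto
  ultimately show ?thesis
    by (simp add: has_prod_def raw_has_prod_def P_def)
qed

lemma fps_cutoff_prodinf:
  assumes "fps_multipliable (g :: nat \<Rightarrow> 'a::idom fps)" "m \<le> N"
  shows "fps_cutoff m (\<Prod>i. g i) = fps_cutoff m (\<Prod>i<N. g i)"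
  unfolding fps_cutoff_eq_fps_cutoff_iff
proof (intro allI impI)
  fix n assume "n < m"
  hence "Suc n \<le> N" using assms(2) by simp
  hence "fps_nth (\<Prod>i<Suc n. g i) n = fps_nth (\<Prod>i<N. g i) n"
    using fps_cutoff_prod_lessThan[OF assms(1)] by (metis fps_cutoff_eq_fps_cutoff_iff lessI)
  thus "fps_nth (\<Prod>i. g i) n = fps_nth (\<Prod>i<N. g i) n"
    using has_prod_unique[OF fps_multipliable_has_prod[OF assms(1)]] by (metis fps_nth_Abs_fps)
qed

lemma fps_nth_prodinf:
  fixes g :: "nat \<Rightarrow> 'a::idom fps"
  assumes "fps_multipliable g" "n < N"
  shows "fps_nth (\<Prod>i. g i) n = fps_nth (\<Prod>i<N. g i) n"
  using fps_cutoff_prodinf[of g "Suc n" N] assms by (simp add: fps_cutoff_eq_fps_cutoff_iff)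

lemma fps_nth_0_prodinf:
  fixes g :: "nat \<Rightarrow> 'a::idom fps"
  assumes "fps_multipliable g"
  shows "fps_nth (\<Prod>i. g i) 0 = 1"
  using fps_nth_prodinf[OF assms, of 0 1] fps_multipliableD[OF assms, of 1 0]
  by (simp add: fps_cutoff_eq_fps_cutoff_iff)

lemma fps_prodinf_mult:
  fixes f g :: "nat \<Rightarrow> 'a::idom fps"
  assumes "fps_multipliable f" "fps_multipliable g"
  shows "(\<Prod>i. f i * g i) = (\<Prod>i. f i) * (\<Prod>i. g i)"
proof (rule fps_eq_if_cutoffs_eq)
  fix m
  have "fps_cutoff m (\<Prod>i. f i * g i) = fps_cutoff m ((\<Prod>i<m. f i) * (\<Prod>i<m. g i))"
    using fps_cutoff_prodinf[OF fps_multipliable_mult[OF assms]] by (simp add: prod.distrib)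
  also have "\<dots> = fps_cutoff m ((\<Prod>i. f i) * (\<Prod>i. g i))"
    using assms by (intro fps_cutoff_mult_cong fps_cutoff_prodinf[symmetric]) simp_all
  finally show "fps_cutoff m (\<Prod>i. f i * g i) = fps_cutoff m ((\<Prod>i. f i) * (\<Prod>i. g i))" .
qed

lemma fps_prodinf_prod:
  fixes f :: "'b \<Rightarrow> nat \<Rightarrow> 'a::idom fps"
  assumes "\<And>r. r \<in> I \<Longrightarrow> fps_multipliable (f r)"
  shows "(\<Prod>i. \<Prod>r\<in>I. f r i) = (\<Prod>r\<in>I. \<Prod>i. f r i)"
  using assms
proof (induction I rule: infinite_finite_induct)
  case (insert r I)
  thus ?case by (simp add: fps_prodinf_mult fps_multipliable_prod)
qed (simp_all add: has_prod_unique[OF has_prod_one, symmetric])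

lemma fps_prodinf_group:
  fixes g :: "nat \<Rightarrow> 'a::idom fps"
  assumes "fps_multipliable g" "s > 0"
  shows "(\<Prod>i. \<Prod>r<s. g (s * i + r)) = (\<Prod>i. g i)"
proof (rule fps_eq_if_cutoffs_eq)
  fix m
  have "fps_multipliable (\<lambda>i. \<Prod>r<s. g (s * i + r))"
    using assms(2)
    by (intro fps_multipliable_prod fps_multipliable_comp[OF assms(1)]) (simp add: trans_le_add1)
  hence "fps_cutoff m (\<Prod>i. \<Prod>r<s. g (s * i + r)) = fps_cutoff m (\<Prod>i<m. \<Prod>r<s. g (s * i + r))"
    by (rule fps_cutoff_prodinf) simp
  also have "(\<Prod>r<s. g (s * i + r)) = prod g {i * s..<i * s + s}" for i
    using prod.shift_bounds_nat_ivl[of g 0 "i * s" s] by (simp add: ac_simps lessThan_atLeast0)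
  hence "(\<Prod>i<m. \<Prod>r<s. g (s * i + r)) = (\<Prod>i<m * s. g i)"
    by (simp only: prod.nat_group)
  also have "fps_cutoff m \<dots> = fps_cutoff m (\<Prod>i. g i)"
    using assms by (intro fps_cutoff_prodinf[symmetric]) simp_all
  finally show "fps_cutoff m (\<Prod>i. \<Prod>r<s. g (s * i + r)) = fps_cutoff m (\<Prod>i. g i)" .
qed

text \<open>The q-Pochhammer symbol (c q^a; q^d) with infinitely many factors.\<close>
definition qpoch :: "'a::idom \<Rightarrow> nat \<Rightarrow> nat \<Rightarrow> 'a fps" where
  "qpoch c a d = (\<Prod>i. 1 - fps_const c * fps_X ^ (a + d * i))"

lemma qpoch_nonzero:
  assumes "a > 0" "d > 0"
  shows "qpoch c a d \<noteq> 0"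
proof
  assume "qpoch c a d = 0"
  moreover have "fps_nth (qpoch c a d) 0 = 1"
    unfolding qpoch_def by (intro fps_nth_0_prodinf fps_multipliable_one_minus_X_power assms)
  ultimately show False by simp
qed

lemma qpoch_dissection:
  assumes "a > 0" "d > 0" "s > 0"
  shows "qpoch c a d = (\<Prod>r<s. qpoch c (a + d * r) (d * s))"
proof -
  have "qpoch c a d = (\<Prod>i. \<Prod>r<s. 1 - fps_const c * fps_X ^ (a + d * (s * i + r)))"
    unfolding qpoch_def
    by (rule fps_prodinf_group[OF fps_multipliable_one_minus_X_power, symmetric]) (use assms in auto)
  also have "\<dots> = (\<Prod>i. \<Prod>r<s. 1 - fps_const c * fps_X ^ (a + d * r + d * s * i))"
    by (simp add: algebra_simps)
  also have "\<dots> = (\<Prod>r<s. qpoch c (a + d * r) (d * s))"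
    unfolding qpoch_def using assms by (intro fps_prodinf_prod fps_multipliable_one_minus_X_power) auto
  finally show ?thesis .
qed

abbreviation euler_prod :: "nat \<Rightarrow> 'a::idom fps" (\<open>\<f>\<close>) where
  "\<f> k \<equiv> qpoch 1 k k"

lemma euler_prod_dissection:
  assumes "k > 0" "s > 0"
  shows "\<f> k = (\<Prod>r<s. qpoch 1 ((r + 1) * k) (s * k))"
  using qpoch_dissection[of k k s 1] assms by (simp add: algebra_simps)

section \<open>Generating functions of weighted sets\<close>

definition gen_fun :: "'b set \<Rightarrow> ('b \<Rightarrow> int) \<Rightarrow> 'a::comm_ring_1 fps" where
  "gen_fun A w = Abs_fps (\<lambda>n. of_nat (card {x \<in> A. w x = int n}))"

definition finite_weight :: "'b set \<Rightarrow> ('b \<Rightarrow> int) \<Rightarrow> bool" where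
  "finite_weight A w \<longleftrightarrow> (\<forall>x\<in>A. 0 \<le> w x) \<and> (\<forall>n. finite {x \<in> A. w x = n})"

lemma finite_weightD:
  assumes "finite_weight A w"
  shows "x \<in> A \<Longrightarrow> 0 \<le> w x" and "finite {x \<in> A. w x = n}"
  using assms by (auto simp: finite_weight_def)

lemma finite_weight_comp:
  assumes "finite_weight A w" "inj_on h B" "h ` B \<subseteq> A"
  shows "finite_weight B (\<lambda>x. w (h x))"
  unfolding finite_weight_def
proof (intro conjI allI ballI)
  show "0 \<le> w (h x)" if "x \<in> B" for x
    using that assms by (auto simp: finite_weight_def)
  show "finite {x \<in> B. w (h x) = n}" for n
  proof (rule inj_on_finite[OF _ _ finite_weightD(2)[OF assms(1)]])
    show "inj_on h {x \<in> B. w (h x) = n}"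
      using assms(2) by (rule inj_on_subset) auto
    show "h ` {x \<in> B. w (h x) = n} \<subseteq> {x \<in> A. w x = n}"
      using assms(3) by auto
  qed
qed

lemma gen_fun_reindex:
  assumes "bij_betw h B A" "\<And>x. x \<in> B \<Longrightarrow> w (h x) = v x"
  shows "gen_fun A w = gen_fun B v"
proof -
  have "h ` {x \<in> B. v x = int n} = {x \<in> A. w x = int n}" for n
    using assms(2) bij_betw_imp_surj_on[OF assms(1)] by force
  hence "bij_betw h {x \<in> B. v x = int n} {x \<in> A. w x = int n}" for n
    by (intro bij_betw_subset[OF assms(1)]) auto
  hence "card {x \<in> A. w x = int n} = card {x \<in> B. v x = int n}" for n
    by (rule bij_betw_same_card[symmetric])
  thus ?thesis by (simp add: gen_fun_def)
qed

text \<open>Doubling clears the denominator 2 in the exponents of theta series.\<close>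
lemma gen_fun_reindex_UNIV:
  assumes "\<And>x. g (h x) = x" "\<And>y. h (g y) = y" "\<And>x. 2 * w (h x) = 2 * v x"
  shows "gen_fun UNIV w = gen_fun UNIV v"
  by (rule gen_fun_reindex[of h, OF bij_betw_byWitness[where f' = g]]) (use assms in auto)

lemma gen_fun_partition:
  assumes "finite_weight A w" "finite I" "g ` A \<subseteq> I"
  shows "gen_fun A w = (\<Sum>r\<in>I. gen_fun {x \<in> A. g x = r} w)"
proof (rule fps_ext)
  fix n
  have "card {x \<in> A. w x = int n} = (\<Sum>r\<in>I. card {x \<in> {x \<in> A. w x = int n}. g x = r})"
    using sum.group[of "{x \<in> A. w x = int n}" I g "\<lambda>_. 1 :: nat"] assms finite_weightD(2)[OF assms(1)]
    unfolding card_eq_sum by (simp add: image_subset_iff)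
  thus "fps_nth (gen_fun A w) n = fps_nth (\<Sum>r\<in>I. gen_fun {x \<in> A. g x = r} w) n"
    by (simp add: gen_fun_def fps_sum_nth conj_ac)
qed

lemma gen_fun_X_power_mult:
  assumes "finite_weight A w"
  shows "fps_X ^ c * gen_fun A w = gen_fun A (\<lambda>x. w x + int c)"
proof (rule fps_ext)
  fix n
  have "{x \<in> A. w x + int c = int n} = (if n < c then {} else {x \<in> A. w x = int (n - c)})"
    using assms unfolding finite_weight_def by auto
  thus "fps_nth (fps_X ^ c * gen_fun A w) n = fps_nth (gen_fun A (\<lambda>x. w x + int c)) n"
    by (simp add: gen_fun_def fps_X_power_mult_nth)
qed

lemma weight_sum_level_set:
  assumes "finite_weight A w" "finite_weight B v"
  shows "{z \<in> A \<times> B. (case z of (x, y) \<Rightarrow> w x + v y) = int n} =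
    (\<Union>i\<in>{0..n}. {x \<in> A. w x = int i} \<times> {y \<in> B. v y = int (n - i)})"
proof (intro equalityI subsetI)
  fix z assume "z \<in> {z \<in> A \<times> B. (case z of (x, y) \<Rightarrow> w x + v y) = int n}"
  then obtain x y where xy: "z = (x, y)" "x \<in> A" "y \<in> B" "w x + v y = int n" by auto
  hence "0 \<le> w x" "0 \<le> v y"
    using finite_weightD(1) assms by metis+
  with xy show "z \<in> (\<Union>i\<in>{0..n}. {x \<in> A. w x = int i} \<times> {y \<in> B. v y = int (n - i)})"
    by (intro UN_I[of "nat (w x)"]) (auto simp: nat_le_iff)
qed auto

lemma finite_weight_Times:
  assumes "finite_weight A w" "finite_weight B v"
  shows "finite_weight (A \<times> B) (\<lambda>(x, y). w x + v y)"
proof -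
  have nonneg: "\<forall>z\<in>A \<times> B. 0 \<le> (case z of (x, y) \<Rightarrow> w x + v y)"
    using finite_weightD(1)[OF assms(1)] finite_weightD(1)[OF assms(2)] by auto
  have "finite {z \<in> A \<times> B. (case z of (x, y) \<Rightarrow> w x + v y) = n}" for n
  proof (cases "0 \<le> n")
    case True
    then obtain m where "n = int m" using nonneg_int_cases by metis
    thus ?thesis
      unfolding \<open>n = int m\<close> weight_sum_level_set[OF assms]
      by (intro finite_UN_I finite_cartesian_product finite_weightD(2)[OF assms(1)]
          finite_weightD(2)[OF assms(2)]) simp
  next
    case False
    hence "{z \<in> A \<times> B. (case z of (x, y) \<Rightarrow> w x + v y) = n} = {}"
      using nonneg by fastforce
    thus ?thesis by (simp only: finite.emptyI)
  qed
  with nonneg show ?thesis by (simp add: finite_weight_def)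
qed

lemma gen_fun_mult:
  assumes "finite_weight A w" "finite_weight B v"
  shows "gen_fun A w * gen_fun B v = gen_fun (A \<times> B) (\<lambda>(x, y). w x + v y)"
proof (rule fps_ext)
  fix n
  have "card (\<Union>i\<in>{0..n}. {x \<in> A. w x = int i} \<times> {y \<in> B. v y = int (n - i)}) =
      (\<Sum>i=0..n. card {x \<in> A. w x = int i} * card {y \<in> B. v y = int (n - i)})"
    using finite_weightD(2)[OF assms(1)] finite_weightD(2)[OF assms(2)]
    by (subst card_UN_disjoint) (auto simp: card_cartesian_product simp del: of_nat_diff)
  thus "fps_nth (gen_fun A w * gen_fun B v) n = fps_nth (gen_fun (A \<times> B) (\<lambda>(x, y). w x + v y)) n"
    unfolding gen_fun_def fps_nth_Abs_fps weight_sum_level_set[OF assms]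
    by (simp add: fps_mult_nth)
qed

lemma gen_fun_residues:
  fixes w :: "int \<Rightarrow> int"
  assumes "finite_weight UNIV w" "d > 0"
  shows "gen_fun UNIV w = (\<Sum>r<d. gen_fun UNIV (\<lambda>c. w (int d * c + int r)))"
proof -
  have "gen_fun UNIV w = (\<Sum>r<d. gen_fun {k \<in> UNIV. nat (k mod int d) = r} w)"
    using assms by (intro gen_fun_partition) (auto simp: nat_less_iff)
  also have "\<dots> = (\<Sum>r<d. gen_fun UNIV (\<lambda>c. w (int d * c + int r)))"
  proof (intro sum.cong refl gen_fun_reindex)
    fix r assume "r \<in> {..<d}"
    moreover have "int d * (k div int d) + int r = k" if "nat (k mod int d) = r" for k
      using that assms(2) by auto
    ultimately show "bij_betw (\<lambda>c. int d * c + int r) UNIV {k \<in> UNIV. nat (k mod int d) = r}"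
      by (intro bij_betw_byWitness[where f' = "\<lambda>k. k div int d"]) auto
  qed simp
  finally show ?thesis .
qed

lemma gen_fun_lattice_residues:
  fixes w :: "int \<times> int \<Rightarrow> int"
  assumes "finite_weight UNIV w" "d > 0"
  shows "gen_fun UNIV w = (\<Sum>r<d. gen_fun UNIV (\<lambda>(c, j). w (int d * c + m * j + int r, j)))"
proof -
  let ?res = "\<lambda>(k, j). nat ((k - m * j) mod int d)"
  have "gen_fun UNIV w = (\<Sum>r<d. gen_fun {x \<in> UNIV. ?res x = r} w)"
    using assms by (intro gen_fun_partition) (auto simp: nat_less_iff)
  also have "\<dots> = (\<Sum>r<d. gen_fun UNIV (\<lambda>(c, j). w (int d * c + m * j + int r, j)))"
  proof (intro sum.cong refl gen_fun_reindex)
    fix r assume "r \<in> {..<d}"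
    moreover have "int d * ((k - m * j) div int d) + m * j + int r = k" if "?res (k, j) = r" for k j
      using that assms(2) by auto
    ultimately show "bij_betw (\<lambda>(c, j). (int d * c + m * j + int r, j)) UNIV {x \<in> UNIV. ?res x = r}"
      by (intro bij_betw_byWitness[where f' = "\<lambda>(k, j). ((k - m * j) div int d, j)"]) auto
  qed auto
  finally show ?thesis .
qed

lemma gen_fun_scale:
  assumes "c > 0"
  shows "gen_fun A (\<lambda>x. int c * w x) = gen_fun A w oo fps_X ^ c"
proof (rule fps_ext)
  fix n
  have "{x \<in> A. int c * w x = int n} = (if c dvd n then {x \<in> A. w x = int (n div c)} else {})"
  proof (cases "c dvd n")
    case True
    then obtain m where "n = c * m" by auto
    thus ?thesis using assms by auto
  next
    case False
    hence "int c * y \<noteq> int n" for y by (metis dvd_triv_left int_dvd_int_iff)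
    with False show ?thesis by auto
  qed
  thus "fps_nth (gen_fun A (\<lambda>x. int c * w x)) n = fps_nth (gen_fun A w oo fps_X ^ c) n"
    by (simp add: gen_fun_def fps_nth_compose_X_power)
qed

section \<open>Theta series\<close>

definition theta_exp :: "nat \<Rightarrow> nat \<Rightarrow> int \<Rightarrow> int" where
  "theta_exp a b k = (int a * (k * (k + 1)) + int b * (k * (k - 1))) div 2"

text \<open>Ramanujan's theta function f(q^a, q^b).\<close>
definition theta :: "nat \<Rightarrow> nat \<Rightarrow> 'a::comm_ring_1 fps" where
  "theta a b = gen_fun UNIV (theta_exp a b)"

lemma two_times_theta_exp: "2 * theta_exp a b k = int a * (k * (k + 1)) + int b * (k * (k - 1))"
proof -
  have "even (int a * (k * (k + 1)) + int b * (k * (k - 1)))" by auto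
  thus ?thesis unfolding theta_exp_def by simp
qed

lemma theta_exp_scale: "theta_exp (c * a) (c * b) k = int c * theta_exp a b k"
proof -
  have "2 * theta_exp (c * a) (c * b) k = int c * (2 * theta_exp a b k)"
    unfolding two_times_theta_exp by (simp add: algebra_simps)
  thus ?thesis by simp
qed

lemma abs_le_theta_exp:
  assumes "a > 0" "b > 0"
  shows "\<bar>k\<bar> \<le> theta_exp a b k"
proof -
  have nonneg: "0 \<le> k * (k + 1)" "0 \<le> k * (k - 1)"
    by (cases "k \<ge> 0"; simp add: zero_le_mult_iff; linarith)+
  hence "1 * (k * (k + 1)) \<le> int a * (k * (k + 1))" "1 * (k * (k - 1)) \<le> int b * (k * (k - 1))"
    using assms by (intro mult_right_mono; simp)+
  hence "2 * (k * k) \<le> 2 * theta_exp a b k"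
    unfolding two_times_theta_exp by (simp add: algebra_simps)
  moreover have "\<bar>k\<bar> \<le> k * k"
    using nonneg by (simp add: algebra_simps abs_if)
  ultimately show ?thesis by linarith
qed

lemma finite_weight_theta_exp:
  assumes "a > 0" "b > 0"
  shows "finite_weight UNIV (theta_exp a b)"
  unfolding finite_weight_def
proof (intro conjI allI ballI)
  show "0 \<le> theta_exp a b k" for k
    using abs_le_theta_exp[OF assms, of k] by linarith
  fix n
  have "k \<in> {- n..n}" if "theta_exp a b k = n" for k
    using abs_le_theta_exp[OF assms, of k] that by auto
  hence "{k \<in> UNIV. theta_exp a b k = n} \<subseteq> {- n..n}" by blast
  thus "finite {k \<in> UNIV. theta_exp a b k = n}"
    by (rule finite_subset) simp
qed

lemma theta_compose_X_power:
  assumes "c > 0"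
  shows "theta a b oo fps_X ^ c = theta (c * a) (c * b)"
  unfolding theta_def theta_exp_scale[abs_def] by (rule gen_fun_scale[OF assms, symmetric])

definition theta_residue :: "nat \<Rightarrow> nat \<Rightarrow> nat \<Rightarrow> nat \<Rightarrow> 'a::comm_ring_1 fps" where
  "theta_residue a b d r = gen_fun UNIV (\<lambda>k. theta_exp a b (int d * k + int r))"

lemma theta_dissection:
  assumes "a > 0" "b > 0" "d > 0"
  shows "theta a b = (\<Sum>r<d. theta_residue a b d r)"
  unfolding theta_def theta_residue_def
  by (rule gen_fun_residues[OF finite_weight_theta_exp[OF assms(1,2)] assms(3)])

lemma theta_eq_theta_residue: "theta a b = theta_residue a b 1 0"
  by (simp add: theta_def theta_residue_def)

lemma finite_weight_theta_residue:
  assumes "a > 0" "b > 0" "d > 0"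
  shows "finite_weight UNIV (\<lambda>k. theta_exp a b (int d * k + int r))"
  using assms by (intro finite_weight_comp[OF finite_weight_theta_exp]) (auto simp: inj_on_def)

lemma X_power_mult_theta_residue:
  assumes "a > 0" "b > 0" "d > 0"
  shows "fps_X ^ n * theta_residue a b d r =
    gen_fun UNIV (\<lambda>k. theta_exp a b (int d * k + int r) + int n)"
  unfolding theta_residue_def
  by (rule gen_fun_X_power_mult[OF finite_weight_theta_residue[OF assms]])

lemma X_power_mult_theta_residue_mult:
  assumes "a > 0" "b > 0" "d > 0" "a' > 0" "b' > 0" "d' > 0"
  shows "fps_X ^ n * (theta_residue a b d r * theta_residue a' b' d' r') =
    gen_fun UNIV (\<lambda>(k, j). theta_exp a b (int d * k + int r) +
      theta_exp a' b' (int d' * j + int r') + int n)"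
proof -
  note fin = finite_weight_theta_residue[OF assms(1-3), of r]
    finite_weight_theta_residue[OF assms(4-6), of r']
  show ?thesis
    unfolding theta_residue_def gen_fun_mult[OF fin] gen_fun_X_power_mult[OF finite_weight_Times[OF fin]]
    by (simp add: case_prod_unfold)
qed

definition theta_lattice_residue ::
    "nat \<Rightarrow> nat \<Rightarrow> nat \<Rightarrow> nat \<Rightarrow> nat \<Rightarrow> int \<Rightarrow> nat \<Rightarrow> 'a::comm_ring_1 fps" where
  "theta_lattice_residue a b a' b' d m r =
    gen_fun UNIV (\<lambda>(k, j). theta_exp a b (int d * k + m * j + int r) + theta_exp a' b' j)"

lemma theta_mult_dissection:
  assumes "a > 0" "b > 0" "a' > 0" "b' > 0" "d > 0"
  shows "(theta a b * theta a' b' :: 'a::comm_ring_1 fps) =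
    (\<Sum>r<d. theta_lattice_residue a b a' b' d m r)"
proof -
  have "finite_weight UNIV (\<lambda>(k, j). theta_exp a b k + theta_exp a' b' j)"
    using finite_weight_Times[OF finite_weight_theta_exp[OF assms(1,2)]
        finite_weight_theta_exp[OF assms(3,4)]] by simp
  from gen_fun_lattice_residues[OF this assms(5), of m] show ?thesis
    using X_power_mult_theta_residue_mult[of a b 1 a' b' 1 0 0 0, where ?'a = 'a] assms
    by (simp add: theta_eq_theta_residue theta_lattice_residue_def case_prod_unfold)
qed

lemma theta_diag:
  assumes "a > 0"
  shows "theta a a = 1 + 2 * (gen_fun {0<..} (theta_exp a a) :: 'a::comm_ring_1 fps)"
proof -
  let ?g = "\<lambda>A. gen_fun A (theta_exp a a) :: 'a fps"
  have square: "theta_exp a a k = int a * k\<^sup>2" for k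
    using two_times_theta_exp[of a a k] by (simp add: algebra_simps power2_eq_square)
  have "theta a a = (\<Sum>s\<in>{-1, 0, 1}. ?g {k \<in> UNIV. sgn k = s})"
    unfolding theta_def using assms
    by (intro gen_fun_partition finite_weight_theta_exp) (auto simp: sgn_if)
  moreover have "{k \<in> UNIV. sgn k = -1} = ({..<0} :: int set)" "{k \<in> UNIV. sgn k = 0} = {0 :: int}"
    "{k \<in> UNIV. sgn k = 1} = ({0<..} :: int set)"
    by (auto simp: sgn_if split: if_splits)
  moreover have "?g {..<0} = ?g {0<..}"
    by (rule gen_fun_reindex[of uminus])
       (auto simp: square intro!: bij_betw_byWitness[where f' = uminus])
  moreover have "{k \<in> {0}. theta_exp a a k = int n} = (if n = 0 then {0} else {})" for n
    by (auto simp: square)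
  hence "?g {0} = 1"
    by (intro fps_ext) (simp add: gen_fun_def)
  ultimately show ?thesis by simp
qed

lemmas doubled_weight_simps = split_paired_all prod.case distrib_left two_times_theta_exp

lemma theta_1_3_dissection:
  "theta 1 3 = theta 3 6 + fps_X * (theta 9 27 :: 'a::comm_ring_1 fps)"
proof -
  let ?R = "theta_residue 1 3 3 :: nat \<Rightarrow> 'a fps"
  have shifted: "fps_X * theta 9 27 = gen_fun UNIV (\<lambda>k. theta_exp 9 27 k + 1)"
    using X_power_mult_theta_residue[of 9 27 1 1 0] by (simp add: theta_eq_theta_residue)
  have "?R 0 = theta_residue 3 6 2 0"
    unfolding theta_residue_def
    by (rule gen_fun_reindex_UNIV[of id id])
       (simp_all only: doubled_weight_simps, simp_all add: algebra_simps)
  moreover have "?R 1 = fps_X * theta 9 27"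
    unfolding theta_residue_def shifted
    by (rule gen_fun_reindex_UNIV[of uminus uminus])
       (simp_all only: doubled_weight_simps, simp_all add: algebra_simps)
  moreover have "?R 2 = theta_residue 3 6 2 1"
    unfolding theta_residue_def
    by (rule gen_fun_reindex_UNIV[of "\<lambda>k. - 1 - k" "\<lambda>k. - 1 - k"])
       (simp_all only: doubled_weight_simps, simp_all add: algebra_simps)
  moreover have "theta 1 3 = ?R 0 + ?R 1 + ?R 2"
    by (subst theta_dissection[of _ _ 3]) (simp_all add: lessThan_nat_numeral add_ac)
  moreover have "theta 3 6 = theta_residue 3 6 2 0 + (theta_residue 3 6 2 1 :: 'a fps)"
    by (subst theta_dissection[of _ _ 2]) (simp_all add: lessThan_nat_numeral add_ac)
  ultimately show ?thesis
    by (simp add: add_ac)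
qed

lemma theta_1_3_lattice_residues_5:
  defines "L \<equiv> theta_lattice_residue 1 3 1 3 5 2 :: nat \<Rightarrow> 'a::comm_ring_1 fps"
    and "P \<equiv> theta_residue 1 4 2 :: nat \<Rightarrow> 'a fps"
    and "Q \<equiv> theta_residue 2 3 2 :: nat \<Rightarrow> 'a fps"
  shows "L 0 = P 0 * Q 0"
    and "L 1 = fps_X * theta 5 15 ^ 2"
    and "L 2 = P 1 * Q 1"
    and "L 3 = P 1 * Q 0"
    and "L 4 = P 0 * Q 1"
proof -
  have PQ: "P r * Q s =
      gen_fun UNIV (\<lambda>(k, j). theta_exp 1 4 (2 * k + int r) + theta_exp 2 3 (2 * j + int s))" for r s
    using X_power_mult_theta_residue_mult[of 1 4 2 2 3 2 0 r s] by (simp add: P_def Q_def)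
  have theta_5_15: "fps_X * theta 5 15 ^ 2 =
      (gen_fun UNIV (\<lambda>(k, j). theta_exp 5 15 k + theta_exp 5 15 j + 1) :: 'a fps)"
    using X_power_mult_theta_residue_mult[of 5 15 1 5 15 1 1 0 0]
    by (simp add: theta_eq_theta_residue power2_eq_square)
  show "L 0 = P 0 * Q 0"
    unfolding L_def theta_lattice_residue_def PQ
    by (rule gen_fun_reindex_UNIV[of "\<lambda>(k, j). (j + 2 * k, - k)" "\<lambda>(a, b). (- b, a + 2 * b)"])
       (simp_all only: doubled_weight_simps, simp_all add: algebra_simps)
  show "L 1 = fps_X * theta 5 15 ^ 2"
    unfolding L_def theta_lattice_residue_def theta_5_15
    by (rule gen_fun_reindex_UNIV[of "\<lambda>(k, j). (- 2 * k - j, - k)" "\<lambda>(a, b). (- b, 2 * b - a)"])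
       (simp_all only: doubled_weight_simps, simp_all add: algebra_simps)
  show "L 2 = P 1 * Q 1"
    unfolding L_def theta_lattice_residue_def PQ
    by (rule gen_fun_reindex_UNIV[of "\<lambda>(k, j). (- j - 1 - 2 * k, k)"
          "\<lambda>(a, b). (b, - (a + 2 * b + 1))"])
       (simp_all only: doubled_weight_simps, simp_all add: algebra_simps)
  show "L 3 = P 1 * Q 0"
    unfolding L_def theta_lattice_residue_def PQ
    by (rule gen_fun_reindex_UNIV[of "\<lambda>(k, j). (- k - 1, - 2 * k - 1 - j)"
          "\<lambda>(a, b). (- a - 1, 2 * a - b + 1)"])
       (simp_all only: doubled_weight_simps, simp_all add: algebra_simps)
  show "L 4 = P 0 * Q 1"
    unfolding L_def theta_lattice_residue_def PQ
    by (rule gen_fun_reindex_UNIV[of "\<lambda>(k, j). (k + 1, j + 2 * k + 1)"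
          "\<lambda>(a, b). (a - 1, b - 2 * a + 1)"])
       (simp_all only: doubled_weight_simps, simp_all add: algebra_simps)
qed

text \<open>With u = 4k - 1 and v = 4j - 1, the left-hand side counts the Gaussian integers u + iv of norm
  8n + 2 with u and v congruent to 3 modulo 4, and theta 1 4 * theta 2 3 counts those with odd u and v
  in a fixed nonzero residue class modulo a prime of norm 5. Multiplication by i permutes cyclically
  the four nonzero classes and the four residues of (u, v) modulo 4, so the two counts differ only by
  the zero class, which gives the last term.\<close>
lemma theta_1_3_square:
  "theta 1 3 ^ 2 = theta 1 4 * theta 2 3 + fps_X * (theta 5 15 ^ 2 :: 'a::comm_ring_1 fps)"
proof -
  let ?L = "theta_lattice_residue 1 3 1 3 5 2 :: nat \<Rightarrow> 'a fps"
  let ?P = "theta_residue 1 4 2 :: nat \<Rightarrow> 'a fps" and ?Q = "theta_residue 2 3 2 :: nat \<Rightarrow> 'a fps"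
  have "theta 1 3 ^ 2 = ?L 0 + ?L 1 + ?L 2 + ?L 3 + ?L 4"
    unfolding power2_eq_square
    by (subst theta_mult_dissection[of _ _ _ _ 5 2]) (simp_all add: lessThan_nat_numeral add_ac)
  also have "\<dots> = (?P 0 + ?P 1) * (?Q 0 + ?Q 1) + fps_X * theta 5 15 ^ 2"
    unfolding theta_1_3_lattice_residues_5 by (simp only: algebra_simps)
  also have "?P 0 + ?P 1 = theta 1 4"
    by (subst theta_dissection[of _ _ 2]) (simp_all add: lessThan_nat_numeral add_ac)
  also have "?Q 0 + ?Q 1 = theta 2 3"
    by (subst theta_dissection[of _ _ 2]) (simp_all add: lessThan_nat_numeral add_ac)
  finally show ?thesis .
qed

lemma theta_1_3_lattice_residues_4:
  defines "L \<equiv> theta_lattice_residue 1 3 3 9 4 1 :: nat \<Rightarrow> 'a::comm_ring_1 fps"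
    and "P \<equiv> theta_residue 6 6 2 :: nat \<Rightarrow> 'a fps"
    and "Q \<equiv> theta_residue 2 2 2 :: nat \<Rightarrow> 'a fps"
  shows "L 0 = P 0 * theta 4 12"
    and "L 1 = fps_X * (Q 0 * theta 12 36)"
    and "L 2 = P 1 * theta 4 12"
    and "L 3 = fps_X * (Q 1 * theta 12 36)"
proof -
  have P_theta: "P r * theta 4 12 =
      gen_fun UNIV (\<lambda>(k, j). theta_exp 6 6 (2 * k + int r) + theta_exp 4 12 j)" for r
    using X_power_mult_theta_residue_mult[of 6 6 2 4 12 1 0 r 0]
    by (simp add: P_def theta_eq_theta_residue)
  have Q_theta: "fps_X * (Q r * theta 12 36) =
      gen_fun UNIV (\<lambda>(k, j). theta_exp 2 2 (2 * k + int r) + theta_exp 12 36 j + 1)" for r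
    using X_power_mult_theta_residue_mult[of 2 2 2 12 36 1 1 r 0]
    by (simp add: Q_def theta_eq_theta_residue)
  show "L 0 = P 0 * theta 4 12"
    unfolding L_def theta_lattice_residue_def P_theta
    by (rule gen_fun_reindex_UNIV[of "\<lambda>(k, j). (k, j + k)" "\<lambda>(a, b). (a, b - a)"])
       (simp_all only: doubled_weight_simps, simp_all add: algebra_simps)
  show "L 1 = fps_X * (Q 0 * theta 12 36)"
    unfolding L_def theta_lattice_residue_def Q_theta
    by (rule gen_fun_reindex_UNIV[of "\<lambda>(k, j). (j + k, - k)" "\<lambda>(a, b). (- b, a + b)"])
       (simp_all only: doubled_weight_simps, simp_all add: algebra_simps)
  show "L 2 = P 1 * theta 4 12"
    unfolding L_def theta_lattice_residue_def P_theta
    by (rule gen_fun_reindex_UNIV[of "\<lambda>(k, j). (k, - j - k)" "\<lambda>(a, b). (a, - b - a)"])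
       (simp_all only: doubled_weight_simps, simp_all add: algebra_simps)
  show "L 3 = fps_X * (Q 1 * theta 12 36)"
    unfolding L_def theta_lattice_residue_def Q_theta
    by (rule gen_fun_reindex_UNIV[of "\<lambda>(k, j). (j + k, k + 1)" "\<lambda>(a, b). (b - 1, a - b + 1)"])
       (simp_all only: doubled_weight_simps, simp_all add: algebra_simps)
qed

lemma theta_1_3_mult_theta_3_9:
  "theta 1 3 * theta 3 9 =
    theta 6 6 * theta 4 12 + fps_X * (theta 2 2 * theta 12 36 :: 'a::comm_ring_1 fps)"
proof -
  let ?L = "theta_lattice_residue 1 3 3 9 4 1 :: nat \<Rightarrow> 'a fps"
  let ?P = "theta_residue 6 6 2 :: nat \<Rightarrow> 'a fps" and ?Q = "theta_residue 2 2 2 :: nat \<Rightarrow> 'a fps"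
  have "theta 1 3 * theta 3 9 = ?L 0 + ?L 1 + ?L 2 + ?L 3"
    by (subst theta_mult_dissection[of _ _ _ _ 4 1]) (simp_all add: lessThan_nat_numeral add_ac)
  also have "\<dots> = (?P 0 + ?P 1) * theta 4 12 + fps_X * ((?Q 0 + ?Q 1) * theta 12 36)"
    unfolding theta_1_3_lattice_residues_4 by (simp only: algebra_simps)
  also have "?P 0 + ?P 1 = theta 6 6"
    by (subst theta_dissection[of _ _ 2]) (simp_all add: lessThan_nat_numeral add_ac)
  also have "?Q 0 + ?Q 1 = theta 2 2"
    by (subst theta_dissection[of _ _ 2]) (simp_all add: lessThan_nat_numeral add_ac)
  finally show ?thesis .
qed

section \<open>The Jacobi triple product\<close>

fun qbin :: "'a::comm_ring_1 \<Rightarrow> nat \<Rightarrow> nat \<Rightarrow> 'a" where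
  "qbin q n 0 = 1"
| "qbin q 0 (Suc k) = 0"
| "qbin q (Suc n) (Suc k) = qbin q n k + q ^ Suc k * qbin q n (Suc k)"

definition qfact :: "'a::comm_ring_1 \<Rightarrow> nat \<Rightarrow> 'a" where
  "qfact q n = (\<Prod>i<n. 1 - q ^ Suc i)"

lemma qbin_eq_0: "n < k \<Longrightarrow> qbin q n k = 0"
  by (induction q n k rule: qbin.induct) auto

lemma qbin_Suc_Suc':
  "k \<le> n \<Longrightarrow> qbin q (Suc n) (Suc k) = qbin q n (Suc k) + q ^ (n - k) * qbin q n k"
proof (induction n arbitrary: k)
  case (Suc n)
  show ?case
  proof (cases k)
    case 0
    thus ?thesis using Suc.IH[of 0] by (simp add: algebra_simps)
  next
    case (Suc j)
    hence "j \<le> n" using Suc.prems by simp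
    have shifted: "q ^ Suc (Suc j) * qbin q (Suc n) (Suc (Suc j)) =
        q ^ Suc (Suc j) * qbin q n (Suc (Suc j)) + q ^ (n - j) * q ^ Suc j * qbin q n (Suc j)"
    proof (cases "j = n")
      case False
      hence "q ^ Suc (Suc j) * q ^ (n - Suc j) = q ^ (n - j) * q ^ Suc j"
        using \<open>j \<le> n\<close> unfolding power_add[symmetric] by (intro arg_cong[where f = "(^) q"]) simp
      thus ?thesis
        using Suc.IH[of "Suc j"] False \<open>j \<le> n\<close>
        by (simp only: distrib_left Suc_le_eq le_neq_implies_less mult.assoc[symmetric])
    qed (simp add: qbin_eq_0)
    have "qbin q (Suc (Suc n)) (Suc (Suc j)) =
        qbin q (Suc n) (Suc j) + q ^ Suc (Suc j) * qbin q (Suc n) (Suc (Suc j))"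
      by (rule qbin.simps(3))
    also have "\<dots> = (qbin q n (Suc j) + q ^ Suc (Suc j) * qbin q n (Suc (Suc j))) +
        q ^ (n - j) * (qbin q n j + q ^ Suc j * qbin q n (Suc j))"
      unfolding shifted Suc.IH[OF \<open>j \<le> n\<close>] by (simp only: distrib_left ac_simps)
    finally show ?thesis
      by (simp add: Suc)
  qed
qed auto

lemma qbin_mult_qfact: "qbin q n k * qfact q k = (\<Prod>i<k. 1 - q ^ (n - i))"
proof (induction q n k rule: qbin.induct)
  case (3 q n k)
  have "qbin q (Suc n) (Suc k) * qfact q (Suc k) =
      (qbin q n k * qfact q k) * (1 - q ^ Suc k) + q ^ Suc k * (qbin q n (Suc k) * qfact q (Suc k))"
    by (simp add: qfact_def algebra_simps)
  also have "\<dots> = (\<Prod>i<k. 1 - q ^ (n - i)) * (1 - q ^ Suc k * q ^ (n - k))"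
    unfolding 3 by (simp add: algebra_simps)
  also have "\<dots> = (\<Prod>i<k. 1 - q ^ (n - i)) * (1 - q ^ Suc n)"
  proof (cases "k \<le> n")
    case True
    hence "Suc k + (n - k) = Suc n" by simp
    thus ?thesis by (simp only: power_add [symmetric])
  next
    case False
    hence "(\<Prod>i<k. 1 - q ^ (n - i)) = 0"
      by (intro prod_zero bexI[of _ n]) auto
    thus ?thesis by simp
  qed
  also have "\<dots> = (\<Prod>i<Suc k. 1 - q ^ (Suc n - i))"
    by (subst prod.lessThan_Suc_shift) (simp add: mult.commute)
  finally show ?case .
qed (simp_all add: qfact_def prod_zero)

lemma sum_qbin_Suc:
  "(\<Sum>j\<le>Suc n. qbin q (Suc n) j * f j) = (\<Sum>j\<le>n. qbin q n j * (f (Suc j) + q ^ j * f j))"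
proof -
  have "(\<Sum>j\<le>Suc n. qbin q (Suc n) j * f j) =
      (\<Sum>j\<le>n. qbin q n j * f (Suc j)) + (f 0 + (\<Sum>j\<le>n. qbin q n (Suc j) * (q ^ Suc j * f (Suc j))))"
    by (subst sum.atMost_Suc_shift) (simp add: algebra_simps sum.distrib)
  also have "f 0 + (\<Sum>j\<le>n. qbin q n (Suc j) * (q ^ Suc j * f (Suc j))) = (\<Sum>j\<le>Suc n. qbin q n j * (q ^ j * f j))"
    by (subst sum.atMost_Suc_shift) simp
  finally show ?thesis
    by (simp add: qbin_eq_0 sum.distrib algebra_simps)
qed

lemma sum_qbin_Suc':
  "(\<Sum>j\<le>Suc n. qbin q (Suc n) j * f j) = (\<Sum>j\<le>n. qbin q n j * (f j + q ^ (n - j) * f (Suc j)))"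
proof -
  have "(\<Sum>j\<le>Suc n. qbin q (Suc n) j * f j) =
      f 0 + (\<Sum>j\<le>n. qbin q n (Suc j) * f (Suc j)) + (\<Sum>j\<le>n. qbin q n j * (q ^ (n - j) * f (Suc j)))"
    by (subst sum.atMost_Suc_shift)
       (simp add: qbin_Suc_Suc' algebra_simps sum.distrib del: qbin.simps(3))
  also have "f 0 + (\<Sum>j\<le>n. qbin q n (Suc j) * f (Suc j)) = (\<Sum>j\<le>Suc n. qbin q n j * f j)"
    by (subst sum.atMost_Suc_shift) simp
  finally show ?thesis
    by (simp add: qbin_eq_0 sum.distrib algebra_simps)
qed

lemma theta_exp_step: "theta_exp a b (k + 1) = theta_exp a b k + int a + int (a + b) * k"
proof -
  have "2 * theta_exp a b (k + 1) = 2 * (theta_exp a b k + int a + int (a + b) * k)"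
    unfolding distrib_left two_times_theta_exp by (simp add: algebra_simps)
  thus ?thesis by simp
qed

lemma X_power_theta_exp_shift:
  fixes m n :: nat
  assumes "a > 0" "b > 0"
  defines "e \<equiv> \<lambda>k. fps_X ^ nat (theta_exp a b k) :: 'a::comm_ring_1 fps"
    and "Q \<equiv> fps_X ^ (a + b)"
  shows "k + int m = int n \<Longrightarrow> e k * fps_X ^ (a + (a + b) * n) = e (k + 1) * Q ^ m"
    and "k + 1 + int n = int m \<Longrightarrow> e (k + 1) * fps_X ^ (b + (a + b) * n) = e k * Q ^ m"
proof -
  have nonneg: "0 \<le> theta_exp a b k" for k
    using abs_le_theta_exp[OF assms(1,2), of k] by linarith
  show "e k * fps_X ^ (a + (a + b) * n) = e (k + 1) * Q ^ m" if "k + int m = int n"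
  proof -
    have "int n = k + int m" using that by simp
    hence "theta_exp a b k + int (a + (a + b) * n) = theta_exp a b (k + 1) + int ((a + b) * m)"
      using theta_exp_step[of a b k] by (simp add: algebra_simps)
    hence "nat (theta_exp a b k) + (a + (a + b) * n) = nat (theta_exp a b (k + 1)) + (a + b) * m"
      using nonneg[of k] nonneg[of "k + 1"] by linarith
    thus ?thesis by (simp add: e_def Q_def flip: power_add power_mult)
  qed
  show "e (k + 1) * fps_X ^ (b + (a + b) * n) = e k * Q ^ m" if "k + 1 + int n = int m"
  proof -
    have "int m = k + 1 + int n" using that by simp
    hence "theta_exp a b (k + 1) + int (b + (a + b) * n) = theta_exp a b k + int ((a + b) * m)"
      using theta_exp_step[of a b k] by (simp add: algebra_simps)
    hence "nat (theta_exp a b (k + 1)) + (b + (a + b) * n) = nat (theta_exp a b k) + (a + b) * m"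
      using nonneg[of k] nonneg[of "k + 1"] by linarith
    thus ?thesis by (simp add: e_def Q_def flip: power_add power_mult)
  qed
qed

lemma finite_jacobi_triple_product_left:
  fixes a b :: nat
  defines "Q \<equiv> (fps_X :: 'a::comm_ring_1 fps) ^ (a + b)"
  assumes "a > 0" "b > 0"
  shows "(\<Prod>i<N. 1 + fps_X ^ (b + (a + b) * i)) =
    (\<Sum>j\<le>N. qbin Q N j * fps_X ^ nat (theta_exp a b (int j - int N)))"
proof (induction N)
  case 0
  show ?case by (simp add: theta_exp_def)
next
  case (Suc N)
  let ?f = "\<lambda>j. fps_X ^ nat (theta_exp a b (int j - int (Suc N))) :: 'a fps"
  have "?f (Suc j) * (1 + fps_X ^ (b + (a + b) * N)) = ?f (Suc j) + Q ^ j * ?f j" for j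
    using X_power_theta_exp_shift(2)[OF assms(2,3), of "int j - int (Suc N)" N j, where ?'a = 'a]
    by (simp add: Q_def algebra_simps)
  hence "(\<Sum>j\<le>Suc N. qbin Q (Suc N) j * ?f j) =
      (\<Sum>j\<le>N. qbin Q N j * ?f (Suc j)) * (1 + fps_X ^ (b + (a + b) * N))"
    unfolding sum_qbin_Suc sum_distrib_right by (simp only: mult.assoc)
  thus ?case
    using Suc by simp
qed

lemma finite_jacobi_triple_product:
  fixes a b :: nat
  defines "Q \<equiv> (fps_X :: 'a::comm_ring_1 fps) ^ (a + b)"
  assumes "a > 0" "b > 0"
  shows "(\<Prod>i<M. 1 + fps_X ^ (a + (a + b) * i)) * (\<Prod>i<N. 1 + fps_X ^ (b + (a + b) * i)) =
    (\<Sum>j\<le>M + N. qbin Q (M + N) j * fps_X ^ nat (theta_exp a b (int j - int N)))"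
proof (induction M)
  case 0
  show ?case
    using finite_jacobi_triple_product_left[OF assms(2,3), of N, where ?'a = 'a] by (simp add: Q_def)
next
  case (Suc M)
  let ?f = "\<lambda>j. fps_X ^ nat (theta_exp a b (int j - int N)) :: 'a fps"
  have "?f j * (1 + fps_X ^ (a + (a + b) * M)) = ?f j + Q ^ (M + N - j) * ?f (Suc j)" if "j \<le> M + N" for j
    using X_power_theta_exp_shift(1)[OF assms(2,3), of "int j - int N" "M + N - j" M, where ?'a = 'a]
      that
    by (simp add: Q_def algebra_simps)
  hence "(\<Sum>j\<le>Suc (M + N). qbin Q (Suc (M + N)) j * ?f j) =
      (\<Sum>j\<le>M + N. qbin Q (M + N) j * ?f j) * (1 + fps_X ^ (a + (a + b) * M))"
    unfolding sum_qbin_Suc' sum_distrib_right by (simp add: mult.assoc)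
  thus ?case
    using Suc by (simp add: mult_ac)
qed

lemma fps_cutoff_qfact:
  assumes "d > 0" "m \<le> N"
  shows "fps_cutoff m (qfact (fps_X ^ d :: 'a::idom fps) N) = fps_cutoff m (\<f> d)"
  using fps_cutoff_prodinf[OF fps_multipliable_one_minus_X_power[OF assms(1,1), of 1] assms(2),
      symmetric]
  by (simp add: qpoch_def qfact_def flip: power_mult power_add)

lemma fps_cutoff_qfact_mult_qbin:
  fixes Q :: "'a::idom fps"
  assumes "Q = fps_X ^ d" "d > 0" "m \<le> N" "m \<le> j" "j + m \<le> n"
  shows "fps_cutoff m (qfact Q N * qbin Q n j) = fps_cutoff m 1"
proof -
  have "fps_cutoff m (qfact Q N) = fps_cutoff m (qfact Q j)"
    using assms by (simp add: fps_cutoff_qfact)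
  hence "fps_cutoff m (qfact Q N * qbin Q n j) = fps_cutoff m (qbin Q n j * qfact Q j)"
    unfolding mult.commute[of "qbin Q n j"] by (intro fps_cutoff_mult_cong) simp_all
  also have "qbin Q n j * qfact Q j = (\<Prod>i<j. 1 - Q ^ (n - i))"
    by (rule qbin_mult_qfact)
  also have "fps_cutoff m \<dots> = fps_cutoff m (\<Prod>i<j. 1)"
  proof (rule fps_cutoff_prod_cong)
    fix i assume "i \<in> {..<j}"
    hence "m \<le> n - i" using assms(5) by auto
    also have "n - i \<le> d * (n - i)" using assms(2) by simp
    finally have "m \<le> d * (n - i)" .
    thus "fps_cutoff m (1 - Q ^ (n - i)) = fps_cutoff m 1"
      by (simp add: assms(1) fps_cutoff_eq_fps_cutoff_iff flip: power_mult)
  qed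
  finally show ?thesis by simp
qed

lemma fps_cutoff_theta:
  assumes "a > 0" "b > 0" "m \<le> N"
  shows "fps_cutoff m (theta a b) =
    fps_cutoff m (\<Sum>j\<le>2 * N. fps_X ^ nat (theta_exp a b (int j - int N)) :: 'a::comm_ring_1 fps)"
  unfolding fps_cutoff_eq_fps_cutoff_iff
proof (intro allI impI)
  fix n assume n: "n < m"
  let ?e = "\<lambda>j. theta_exp a b (int j - int N)"
  have "nat (?e j) = n \<longleftrightarrow> ?e j = int n" for j
    using abs_le_theta_exp[OF assms(1,2), of "int j - int N"] by auto
  hence "fps_nth (\<Sum>j\<le>2 * N. fps_X ^ nat (?e j) :: 'a fps) n = (\<Sum>j\<le>2 * N. if ?e j = int n then 1 else 0)"
    by (simp add: fps_sum_nth eq_commute)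
  also have "\<dots> = of_nat (card {j \<in> {..2 * N}. ?e j = int n})"
    by (simp add: sum.If_cases Int_def)
  also have "card {j \<in> {..2 * N}. ?e j = int n} = card {k \<in> UNIV. theta_exp a b k = int n}"
  proof (rule bij_betw_same_card, rule bij_betw_byWitness[where f' = "\<lambda>k. nat (k + int N)"])
    have "\<bar>k\<bar> \<le> int N" if "theta_exp a b k = int n" for k
      using abs_le_theta_exp[OF assms(1,2), of k] that n assms(3) by linarith
    thus "\<forall>k\<in>{k \<in> UNIV. theta_exp a b k = int n}. int (nat (k + int N)) - int N = k"
      and "(\<lambda>k. nat (k + int N)) ` {k \<in> UNIV. theta_exp a b k = int n} \<subseteq> {j \<in> {..2 * N}. ?e j = int n}"
      by fastforce+
  qed auto
  finally show "fps_nth (theta a b) n = fps_nth (\<Sum>j\<le>2 * N. fps_X ^ nat (?e j) :: 'a fps) n"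
    by (simp add: theta_def gen_fun_def)
qed

theorem jacobi_triple_product:
  assumes "a > 0" "b > 0"
  shows "qpoch (- 1) a (a + b) * qpoch (- 1) b (a + b) * qpoch 1 (a + b) (a + b) =
    (theta a b :: 'a::idom fps)"
proof (rule fps_eq_if_cutoffs_eq)
  fix m
  define Q :: "'a fps" where "Q = fps_X ^ (a + b)"
  let ?e = "\<lambda>j. nat (theta_exp a b (int j - int m))"
  let ?A = "(\<Prod>i<m. 1 + fps_X ^ (a + (a + b) * i)) :: 'a fps"
  let ?B = "(\<Prod>i<m. 1 + fps_X ^ (b + (a + b) * i)) :: 'a fps"
  have "fps_cutoff m (qpoch (- 1) c (a + b) :: 'a fps) =
      fps_cutoff m (\<Prod>i<m. 1 + fps_X ^ (c + (a + b) * i))" if "c > 0" for c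
    unfolding qpoch_def using that assms
    by (subst fps_cutoff_prodinf[OF fps_multipliable_one_minus_X_power])
       (simp_all flip: fps_const_neg)
  hence "fps_cutoff m (qpoch (- 1) a (a + b) * qpoch (- 1) b (a + b) * qpoch 1 (a + b) (a + b)) =
      fps_cutoff m (?A * ?B * qfact Q m)"
    unfolding Q_def using assms by (intro fps_cutoff_mult_cong) (simp_all add: fps_cutoff_qfact)
  also have "?A * ?B * qfact Q m = (\<Sum>j\<le>2 * m. qfact Q m * qbin Q (2 * m) j * fps_X ^ ?e j)"
    using finite_jacobi_triple_product[OF assms, of m m, where ?'a = 'a]
    unfolding Q_def by (simp only: mult.commute[of _ "qfact _ _"] sum_distrib_left mult_2 mult.assoc)
  also have "fps_cutoff m \<dots> = fps_cutoff m (\<Sum>j\<le>2 * m. 1 * fps_X ^ ?e j)"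
  proof (intro fps_cutoff_sum_cong fps_cutoff_X_power_mult_cong fps_cutoff_qfact_mult_qbin[OF Q_def])
    fix j
    show "m - ?e j \<le> j" "j + (m - ?e j) \<le> 2 * m" if "j \<in> {..2 * m}"
      using that abs_le_theta_exp[OF assms, of "int j - int m"] by (auto simp: le_nat_iff)
  qed (use assms in auto)
  also have "\<dots> = fps_cutoff m (theta a b)"
    by (simp add: fps_cutoff_theta[OF assms order_refl])
  finally show "fps_cutoff m (qpoch (- 1) a (a + b) * qpoch (- 1) b (a + b) * qpoch 1 (a + b) (a + b)) =
      fps_cutoff m (theta a b :: 'a fps)" .
qed

section \<open>Residue classes of exponents\<close>

definition supported_on :: "nat \<Rightarrow> 'a::zero fps \<Rightarrow> bool" where
  "supported_on d f \<longleftrightarrow> (\<forall>n. fps_nth f n \<noteq> 0 \<longrightarrow> d dvd n)"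

definition residue_part :: "nat \<Rightarrow> nat \<Rightarrow> 'a::zero fps \<Rightarrow> 'a fps" where
  "residue_part d r f = Abs_fps (\<lambda>n. if n mod d = r then fps_nth f n else 0)"

lemma supported_on_mult:
  fixes f g :: "'a::semiring_0 fps"
  assumes "supported_on d f" "supported_on d g"
  shows "supported_on d (f * g)"
  unfolding supported_on_def
proof (intro allI impI)
  fix n assume "fps_nth (f * g) n \<noteq> 0"
  then obtain i where "i \<in> {0..n}" "fps_nth f i * fps_nth g (n - i) \<noteq> 0"
    unfolding fps_mult_nth by (meson sum.not_neutral_contains_not_neutral)
  hence "d dvd i" "d dvd n - i"
    using assms unfolding supported_on_def by (metis mult_zero_left mult_zero_right)+
  hence "d dvd i + (n - i)"
    by (rule dvd_add)
  thus "d dvd n"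
    using \<open>i \<in> {0..n}\<close> by simp
qed

lemma supported_on_power:
  fixes f :: "'a::semiring_1 fps"
  assumes "supported_on d f"
  shows "supported_on d (f ^ m)"
proof (induction m)
  case 0
  show ?case by (auto simp: supported_on_def)
next
  case (Suc m)
  thus ?case using assms by (simp add: supported_on_mult)
qed

lemma supported_on_compose_X_power: "supported_on d (f oo fps_X ^ d)"
  by (simp add: supported_on_def fps_nth_compose_X_power)

lemma residue_part_add:
  "residue_part d r (f + g) = residue_part d r f + residue_part d r (g :: 'a::monoid_add fps)"
  by (rule fps_ext) (simp add: residue_part_def)

lemma residue_part_0: "supported_on d f \<Longrightarrow> residue_part d 0 f = f"
  by (rule fps_ext) (auto simp: residue_part_def supported_on_def)

lemma residue_part_eq_0:
  assumes "supported_on e f" "e dvd d" "\<not> e dvd r"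
  shows "residue_part d r f = 0"
  using assms by (intro fps_ext) (auto simp: residue_part_def supported_on_def dvd_mod_iff)

lemma residue_part_X_mult:
  assumes "Suc r < d"
  shows "residue_part d (Suc r) (fps_X * f) = fps_X * residue_part d r (f :: 'a::semiring_1 fps)"
proof (rule fps_ext)
  show "fps_nth (residue_part d (Suc r) (fps_X * f)) n = fps_nth (fps_X * residue_part d r f) n" for n
    using assms by (cases n) (auto simp: residue_part_def mod_Suc)
qed

lemma residue_part_mult:
  fixes f g :: "'a::semiring_0 fps"
  assumes "supported_on d f"
  shows "residue_part d r (f * g) = f * residue_part d r g"
proof (rule fps_ext)
  fix n
  have "fps_nth f i * fps_nth (residue_part d r g) (n - i) =
      (if n mod d = r then fps_nth f i * fps_nth g (n - i) else 0)" if "i \<in> {0..n}" for i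
  proof (cases "fps_nth f i = 0")
    case False
    hence "d dvd i" using assms by (simp add: supported_on_def)
    hence "(n - i) mod d = n mod d"
      using that by (metis atLeastAtMost_iff mod_eq_dvd_iff_nat diff_diff_cancel diff_le_self)
    thus ?thesis by (simp add: residue_part_def)
  qed simp
  thus "fps_nth (residue_part d r (f * g)) n = fps_nth (f * residue_part d r g) n"
    by (simp add: residue_part_def fps_mult_nth)
qed

section \<open>Partitions with no part divisible by s and no part repeated t times\<close>

lemma sum_mset_eq_sum_count:
  fixes P :: "nat multiset"
  assumes "finite K" "set_mset P \<subseteq> K"
  shows "sum_mset P = (\<Sum>k\<in>K. count P k * k)"
proof -
  obtain xs where "mset xs = P" using ex_mset by blast
  thus ?thesis
    using sum_list_map_eq_sum_count2[of xs K id] assms by (auto simp: sum_mset_sum_list count_mset)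
qed

lemma bij_betw_restrict_count:
  assumes "finite K"
  shows "bij_betw (\<lambda>P. restrict (count P) K)
    {P. set_mset P \<subseteq> K \<and> (\<forall>k\<in>K. count P k < t)} (PiE K (\<lambda>_. {..<t}))"
proof (rule bij_betw_byWitness[where f' = "\<lambda>g. \<Sum>k\<in>K. replicate_mset (g k) k"])
  let ?M = "\<lambda>g. \<Sum>k\<in>K. replicate_mset (g k) k"
  have count_M: "count (?M g) k = (if k \<in> K then g k else 0)" for g k
    using assms by (simp add: count_sum)
  show "\<forall>P\<in>{P. set_mset P \<subseteq> K \<and> (\<forall>k\<in>K. count P k < t)}. ?M (restrict (count P) K) = P"
    by (auto simp: multiset_eq_iff count_M count_eq_zero_iff[symmetric])
  show "\<forall>g\<in>PiE K (\<lambda>_. {..<t}). restrict (count (?M g)) K = g"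
    by (auto simp: count_M PiE_def extensional_def fun_eq_iff)
  show "?M ` PiE K (\<lambda>_. {..<t}) \<subseteq> {P. set_mset P \<subseteq> K \<and> (\<forall>k\<in>K. count P k < t)}"
    by (auto simp: count_M PiE_def simp flip: count_greater_zero_iff split: if_splits)
qed auto

lemma restricted_int_partitions_eq:
  fixes s t n N :: nat
  assumes "t > 0" "n \<le> N"
  defines "K \<equiv> {k \<in> {1..N}. \<not> s dvd k}"
  shows "{P \<in> int_partitions n. (\<forall>k \<in># P. \<not> s dvd k) \<and> (\<forall>k \<in># P. \<not> count P k \<ge> t)} =
    {P. set_mset P \<subseteq> K \<and> (\<forall>k\<in>K. count P k < t) \<and> sum_mset P = n}"
proof (intro Collect_cong iffI)
  fix P assume P: "P \<in> int_partitions n \<and> (\<forall>k \<in># P. \<not> s dvd k) \<and> (\<forall>k \<in># P. \<not> count P k \<ge> t)"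
  have "k \<in> K" if "k \<in># P" for k
  proof -
    have "k \<le> n" using P that by (auto simp: int_partitions_def dest!: multi_member_split)
    moreover have "k \<noteq> 0" using P that by (auto simp: int_partitions_def intro!: gr0I)
    ultimately show ?thesis using P that assms(2) by (simp add: K_def)
  qed
  moreover have "count P k < t" for k
    using P assms(1) by (metis count_inI not_le)
  ultimately show "set_mset P \<subseteq> K \<and> (\<forall>k\<in>K. count P k < t) \<and> sum_mset P = n"
    using P by (auto simp: int_partitions_def)
next
  fix P assume "set_mset P \<subseteq> K \<and> (\<forall>k\<in>K. count P k < t) \<and> sum_mset P = n"
  thus "P \<in> int_partitions n \<and> (\<forall>k \<in># P. \<not> s dvd k) \<and> (\<forall>k \<in># P. \<not> count P k \<ge> t)"
    by (auto simp: int_partitions_def K_def not_le)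
qed

lemma p_RD_eq_card_PiE:
  fixes s t n N :: nat
  assumes "t > 0" "n \<le> N"
  defines "K \<equiv> {k \<in> {1..N}. \<not> s dvd k}"
  shows "p_RD s t n = card {g \<in> PiE K (\<lambda>_. {..<t}). (\<Sum>k\<in>K. g k * k) = n}"
proof -
  let ?S = "{P. set_mset P \<subseteq> K \<and> (\<forall>k\<in>K. count P k < t)}" and ?restrict = "\<lambda>P. restrict (count P) K"
  have fin: "finite K" by (simp add: K_def)
  have "(\<Sum>k\<in>K. ?restrict P k * k) = sum_mset P" if "P \<in> ?S" for P
    using that sum_mset_eq_sum_count[OF fin] by simp
  hence "?restrict ` {P \<in> ?S. sum_mset P = n} = {g \<in> PiE K (\<lambda>_. {..<t}). (\<Sum>k\<in>K. g k * k) = n}"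
    unfolding bij_betw_imp_surj_on[OF bij_betw_restrict_count[OF fin, of t], symmetric] by auto
  hence "bij_betw ?restrict {P \<in> ?S. sum_mset P = n} {g \<in> PiE K (\<lambda>_. {..<t}). (\<Sum>k\<in>K. g k * k) = n}"
    by (intro bij_betw_subset[OF bij_betw_restrict_count[OF fin]]) auto
  thus ?thesis
    unfolding p_RD_def restricted_int_partitions_eq[OF assms(1,2)] K_def[symmetric]
    by (simp add: bij_betw_same_card)
qed

definition rd_factor :: "nat \<Rightarrow> nat \<Rightarrow> nat \<Rightarrow> 'a::comm_ring_1 fps" where
  "rd_factor s t i = (if s dvd Suc i then 1 else (\<Sum>j<t. fps_X ^ (j * Suc i)))"

lemma fps_nth_prod_rd_factor:
  assumes "t > 0" "n \<le> N"
  shows "fps_nth (\<Prod>i<N. rd_factor s t i) n = (of_nat (p_RD s t n) :: 'a::comm_ring_1)"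
proof -
  define K where "K = {k \<in> {1..N}. \<not> s dvd k}"
  have fin: "finite K" by (simp add: K_def)
  have "(\<Prod>i<N. rd_factor s t i :: 'a fps) =
      (\<Prod>k\<in>{1..N}. if s dvd k then 1 else (\<Sum>j<t. fps_X ^ (j * k)))"
    unfolding rd_factor_def
    by (rule prod.reindex_bij_witness[of _ "\<lambda>k. k - 1" Suc]) auto
  also have "\<dots> = (\<Prod>k\<in>K. \<Sum>j<t. fps_X ^ (j * k))"
    unfolding K_def by (rule prod.mono_neutral_cong_right) auto
  also have "\<dots> = (\<Sum>g\<in>PiE K (\<lambda>_. {..<t}). \<Prod>k\<in>K. fps_X ^ (g k * k))"
    by (rule prod_sum_PiE) (auto simp: fin)
  also have "\<dots> = (\<Sum>g\<in>PiE K (\<lambda>_. {..<t}). fps_X ^ (\<Sum>k\<in>K. g k * k))"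
    by (simp add: power_sum)
  finally have "fps_nth (\<Prod>i<N. rd_factor s t i :: 'a fps) n =
      (\<Sum>g\<in>PiE K (\<lambda>_. {..<t}). if (\<Sum>k\<in>K. g k * k) = n then 1 else 0)"
    by (simp add: fps_sum_nth eq_commute)
  also have "\<dots> = of_nat (p_RD s t n)"
    using fin p_RD_eq_card_PiE[OF assms, of s] by (simp add: K_def sum.If_cases finite_PiE Int_def)
  finally show ?thesis .
qed

lemma fps_multipliable_rd_factor:
  assumes "t > 0"
  shows "fps_multipliable (rd_factor s t :: nat \<Rightarrow> 'a::comm_ring_1 fps)"
proof -
  have "fps_nth (\<Sum>j<t. (fps_X :: 'a fps) ^ (j * Suc i)) n = fps_nth 1 n" if "n < Suc i" for n i
  proof -
    have "n = j * Suc i \<longleftrightarrow> j = 0 \<and> n = 0" for j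
      using that by (cases j) auto
    hence "fps_nth (\<Sum>j<t. (fps_X :: 'a fps) ^ (j * Suc i)) n =
        (\<Sum>j<t. if j = 0 then fps_nth 1 n else 0)"
      unfolding fps_sum_nth fps_X_power_nth by (intro sum.cong) simp_all
    thus ?thesis
      using assms by simp
  qed
  thus ?thesis
    by (auto simp: fps_multipliable_def fps_cutoff_eq_fps_cutoff_iff rd_factor_def
        simp del: mult_Suc_right)
qed

definition rd_series :: "nat \<Rightarrow> nat \<Rightarrow> 'a::idom fps" where
  "rd_series s t = Abs_fps (\<lambda>n. of_nat (p_RD s t n))"

lemma rd_series_eq_prodinf: "t > 0 \<Longrightarrow> rd_series s t = (\<Prod>i. rd_factor s t i)"
  by (rule fps_ext)
     (simp add: rd_series_def fps_nth_prodinf[OF fps_multipliable_rd_factor lessI]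
       fps_nth_prod_rd_factor del: prod.lessThan_Suc)

lemma fps_multipliable_euler_factor:
  "k > 0 \<Longrightarrow> fps_multipliable (\<lambda>i. 1 - fps_X ^ (k * Suc i) :: 'a::idom fps)"
  using fps_multipliable_one_minus_X_power[of k k "1 :: 'a"] by simp

lemma euler_prod_eq_prodinf: "\<f> k = (\<Prod>i. 1 - fps_X ^ (k * Suc i) :: 'a::idom fps)"
  by (simp add: qpoch_def)

lemma fps_prodinf_multiples:
  fixes g :: "nat \<Rightarrow> 'a::idom fps"
  assumes "fps_multipliable (\<lambda>i. g (Suc i))" "s > 0"
  shows "(\<Prod>i. if s dvd Suc i then g (Suc i) else 1) = (\<Prod>i. g (s * Suc i))"
proof -
  have "(\<Prod>i. if s dvd Suc i then g (Suc i) else 1) =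
      (\<Prod>i. \<Prod>r<s. if s dvd Suc (s * i + r) then g (Suc (s * i + r)) else 1)"
    using assms by (intro fps_prodinf_group[symmetric]) (simp_all add: fps_multipliable_def)
  moreover have "(\<Prod>r<s. if s dvd Suc (s * i + r) then g (Suc (s * i + r)) else 1) = g (s * Suc i)" for i
  proof -
    have "s dvd Suc (s * i + r) \<longleftrightarrow> r = s - 1" if "r < s" for r
      using that dvd_add_right_iff[of s "s * i" "Suc r"] by (auto dest: dvd_imp_le)
    hence "(\<Prod>r<s. if s dvd Suc (s * i + r) then g (Suc (s * i + r)) else 1) =
        (\<Prod>r<s. if r = s - 1 then g (Suc (s * i + r)) else 1)"
      by (intro prod.cong) simp_all
    thus ?thesis
      using assms(2) by (simp add: algebra_simps)
  qed
  ultimately show ?thesis by simp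
qed

theorem rd_series_mult_euler_prods:
  assumes "s > 0" "t > 0"
  shows "rd_series s t * \<f> 1 * \<f> (s * t) = (\<f> s * \<f> t :: 'a::idom fps)"
proof -
  let ?u = "\<lambda>k i. if s dvd Suc i then 1 - fps_X ^ (k * Suc i) else 1 :: 'a fps"
  have u: "fps_multipliable (?u k)" "(\<Prod>i. ?u k i) = \<f> (s * k)" if "k > 0" for k
    using fps_multipliable_euler_factor[OF that, where ?'a = 'a]
      fps_prodinf_multiples[OF fps_multipliable_euler_factor[OF that, where ?'a = 'a] assms(1)]
    by (simp_all add: fps_multipliable_def euler_prod_eq_prodinf mult_ac)
  have powers: "fps_X ^ (k * Suc i) = (fps_X ^ Suc i :: 'a fps) ^ k" for k i
    by (simp only: mult.commute flip: power_mult)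
  have factor: "rd_factor s t i * (1 - fps_X ^ (1 * Suc i)) * ?u t i =
      (1 - fps_X ^ (t * Suc i)) * ?u 1 i" for i
    unfolding rd_factor_def powers one_diff_power_eq[of _ t] by (simp add: mult_ac del: power_Suc)
  have "rd_series s t * \<f> 1 * \<f> (s * t) =
      (\<Prod>i. rd_factor s t i) * (\<Prod>i. 1 - fps_X ^ (1 * Suc i)) * (\<Prod>i. ?u t i)"
    using assms u by (simp add: rd_series_eq_prodinf euler_prod_eq_prodinf)
  also have "\<dots> = (\<Prod>i. rd_factor s t i * (1 - fps_X ^ (1 * Suc i)) * ?u t i)"
    using fps_multipliable_rd_factor[OF assms(2), of s, where ?'a = 'a]
      fps_multipliable_euler_factor[of 1, where ?'a = 'a] u(1)[OF assms(2)]
    by (simp only: fps_prodinf_mult fps_multipliable_mult zero_less_one)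
  also have "\<dots> = (\<Prod>i. 1 - fps_X ^ (t * Suc i)) * (\<Prod>i. ?u 1 i)"
    unfolding factor using assms
    by (intro fps_prodinf_mult fps_multipliable_euler_factor u(1)) simp_all
  also have "\<dots> = \<f> s * \<f> t"
    using u[of 1] by (simp add: euler_prod_eq_prodinf mult.commute)
  finally show ?thesis .
qed

section \<open>Characteristic 2\<close>

context
  assumes CHAR_2: "CHAR('a::idom) = 2"
begin

lemma theta_eq_qpoch:
  assumes "a > 0" "b > 0"
  shows "(theta a b :: 'a fps) = qpoch 1 a (a + b) * qpoch 1 b (a + b) * qpoch 1 (a + b) (a + b)"
  using jacobi_triple_product[OF assms, where ?'a = 'a] by (simp add: uminus_CHAR_2[OF CHAR_2])

lemma theta_diag_eq_1:
  assumes "a > 0"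
  shows "theta a a = (1 :: 'a fps)"
proof -
  have "(2 :: 'a fps) = 0"
    using of_nat_CHAR[where ?'a = "'a fps"] CHAR_2 by simp
  thus ?thesis by (simp add: theta_diag[OF assms])
qed

lemma euler_prod_double:
  assumes "k > 0"
  shows "\<f> (2 * k) = (\<f> k ^ 2 :: 'a fps)"
proof -
  have square: "(1 - x) * (1 - x) = 1 - x * x" for x :: "'a fps"
  proof -
    have "(1 - x) * (1 - x) = (1 + x) * (1 - x)"
      using minus_CHAR_2[of 1 x] CHAR_2 by simp
    thus ?thesis by (simp add: algebra_simps)
  qed
  have "\<f> (2 * k) = (\<Prod>i. (1 - fps_X ^ (k + k * i)) * (1 - fps_X ^ (k + k * i)) :: 'a fps)"
    unfolding square qpoch_def by (simp add: mult_2 distrib_right add_ac flip: power_add)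
  also have "\<dots> = \<f> k ^ 2"
    using fps_prodinf_mult[OF fps_multipliable_euler_factor fps_multipliable_euler_factor, OF assms assms,
        where ?'a = 'a]
    by (simp add: qpoch_def power2_eq_square)
  finally show ?thesis .
qed

lemma euler_prod_quadruple: "k > 0 \<Longrightarrow> \<f> (4 * k) = (\<f> k ^ 4 :: 'a fps)"
  using euler_prod_double[of k] euler_prod_double[of "2 * k"] by (simp flip: power_mult)

lemma euler_prod_eq_theta:
  assumes "k > 0"
  shows "\<f> k = (theta k (2 * k) :: 'a fps)"
  using assms euler_prod_dissection[of k 3, where ?'a = 'a] theta_eq_qpoch[of k "2 * k"]
  by (simp add: lessThan_nat_numeral mult_ac flip: mult_2_right)

lemma euler_prod_cube_eq_theta:
  assumes "k > 0"
  shows "\<f> k ^ 3 = (theta k (3 * k) :: 'a fps)"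
proof -
  have "theta k (3 * k) * \<f> (2 * k) = (\<f> k * \<f> (4 * k) :: 'a fps)"
    using assms euler_prod_dissection[of k 4, where ?'a = 'a]
      euler_prod_dissection[of "2 * k" 2, where ?'a = 'a] theta_eq_qpoch[of k "3 * k"]
    by (simp add: lessThan_nat_numeral mult_ac flip: mult_2_right)
  hence "theta k (3 * k) * \<f> k ^ 2 = (\<f> k ^ 3 * \<f> k ^ 2 :: 'a fps)"
    using assms by (simp add: euler_prod_double euler_prod_quadruple flip: power_Suc power_add)
  moreover have "\<f> k ^ 2 \<noteq> (0 :: 'a fps)"
    using qpoch_nonzero[OF assms assms] by simp
  ultimately show ?thesis
    by (metis mult_right_cancel)
qed

lemma theta_mult_eq_euler_prod_mult:
  assumes "k > 0"
  shows "theta k (4 * k) * theta (2 * k) (3 * k) = (\<f> k * \<f> (5 * k) :: 'a fps)"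
  using assms euler_prod_dissection[of k 5, where ?'a = 'a] theta_eq_qpoch[of k "4 * k"]
    theta_eq_qpoch[of "2 * k" "3 * k"]
  by (simp add: lessThan_nat_numeral mult_ac flip: mult_2_right)

lemma euler_prod_1_cube: "\<f> 1 ^ 3 = (\<f> 3 + fps_X * \<f> 9 ^ 3 :: 'a fps)"
  using theta_1_3_dissection[where ?'a = 'a] euler_prod_cube_eq_theta[of 1] euler_prod_eq_theta[of 3]
    euler_prod_cube_eq_theta[of 9] by simp

lemma euler_prod_1_mult_5: "\<f> 1 * \<f> 5 = (\<f> 2 ^ 3 + fps_X * \<f> 10 ^ 3 :: 'a fps)"
proof -
  have "theta 1 4 * theta 2 3 = theta 1 3 ^ 2 - (fps_X * theta 5 15 ^ 2 :: 'a fps)"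
    by (simp only: theta_1_3_square add_diff_cancel_right')
  also have "\<dots> = (\<f> 1 ^ 3) ^ 2 + fps_X * (\<f> 5 ^ 3) ^ 2"
    using euler_prod_cube_eq_theta[of 1] euler_prod_cube_eq_theta[of 5]
    by (simp add: minus_CHAR_2 CHAR_2)
  also have "\<dots> = (\<f> 1 ^ 2) ^ 3 + fps_X * (\<f> 5 ^ 2) ^ 3"
    by (simp flip: power_mult)
  finally show ?thesis
    using theta_mult_eq_euler_prod_mult[of 1] euler_prod_double[of 1] euler_prod_double[of 5] by simp
qed

lemma euler_prod_cubes_1_3: "\<f> 1 ^ 3 * \<f> 3 ^ 3 = (\<f> 4 ^ 3 + fps_X * \<f> 12 ^ 3 :: 'a fps)"
  using theta_1_3_mult_theta_3_9[where ?'a = 'a] theta_diag_eq_1 euler_prod_cube_eq_theta[of 1]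
    euler_prod_cube_eq_theta[of 3] euler_prod_cube_eq_theta[of 4] euler_prod_cube_eq_theta[of 12] by simp

lemma euler_prod_compose_X_power: "k > 0 \<Longrightarrow> c > 0 \<Longrightarrow> \<f> k oo fps_X ^ c = (\<f> (c * k) :: 'a fps)"
  by (simp add: euler_prod_eq_theta theta_compose_X_power mult.left_commute)

lemma supported_on_euler_prod:
  assumes "k > 0" "d dvd k"
  shows "supported_on d (\<f> k :: 'a fps)"
proof -
  obtain c where "k = d * c" using assms(2) by blast
  thus ?thesis
    using euler_prod_compose_X_power[of c d] supported_on_compose_X_power assms(1)
    by (metis nat_0_less_mult_iff)
qed

lemma rd_series_2_5_dissection:
  "\<f> 20 * rd_series 2 5 = (\<f> 2 ^ 3 * \<f> 10 + fps_X * \<f> 20 ^ 2 :: 'a fps)"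
proof -
  let ?G = "rd_series 2 5 :: 'a fps"
  have "?G * \<f> 5 * (\<f> 1 * \<f> 5) = \<f> 1 * (\<f> 1 * \<f> 5)"
    using rd_series_mult_euler_prods[of 2 5, where ?'a = 'a] euler_prod_double[of 1]
      euler_prod_double[of 5] by (simp add: power2_eq_square mult_ac)
  hence quotient: "?G * \<f> 5 = \<f> 1"
    using qpoch_nonzero[of _ _ "1 :: 'a"] by simp
  have "\<f> 20 * ?G = ?G * \<f> 5 * \<f> 5 * \<f> 5 ^ 2"
    using euler_prod_quadruple[of 5] by (simp add: power4_eq_xxxx power2_eq_square mult_ac)
  also have "\<dots> = (\<f> 2 ^ 3 + fps_X * \<f> 10 ^ 3) * \<f> 10"
    using euler_prod_double[of 5] by (simp only: quotient euler_prod_1_mult_5) simp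
  also have "\<dots> = \<f> 2 ^ 3 * \<f> 10 + fps_X * \<f> 20 ^ 2"
    using euler_prod_double[of 10] by (simp add: algebra_simps power2_eq_square power3_eq_cube)
  finally show ?thesis .
qed

lemma residue_part_rd_series_2_5: "residue_part 2 1 (rd_series 2 5) = (fps_X * \<f> 20 :: 'a fps)"
proof -
  have even: "supported_on 2 (\<f> 20 :: 'a fps)" "supported_on 2 (\<f> 2 ^ 3 * \<f> 10 :: 'a fps)"
    by (intro supported_on_mult supported_on_power supported_on_euler_prod; simp)+
  have "\<f> 20 * residue_part 2 1 (rd_series 2 5) =
      residue_part 2 1 (\<f> 2 ^ 3 * \<f> 10 + fps_X * \<f> 20 ^ 2 :: 'a fps)"
    by (simp only: residue_part_mult[OF even(1), symmetric] rd_series_2_5_dissection)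
  also have "\<dots> = fps_X * \<f> 20 ^ 2"
    using residue_part_X_mult[of 0 2 "\<f> 20 ^ 2 :: 'a fps"] residue_part_eq_0[OF even(2), of 2 1]
      residue_part_0[OF supported_on_power[OF even(1)], of 2]
    by (simp add: residue_part_add)
  finally have "\<f> 20 * residue_part 2 1 (rd_series 2 5) = \<f> 20 * (fps_X * \<f> 20 :: 'a fps)"
    by (simp add: power2_eq_square mult_ac)
  thus ?thesis
    using qpoch_nonzero[of 20 20 "1 :: 'a"] by simp
qed

lemma rd_series_3_3_dissection:
  "\<f> 4 * \<f> 36 * (fps_X * rd_series 3 3) =
    (\<f> 4 * \<f> 2 * \<f> 6 + \<f> 4 ^ 3 + fps_X * \<f> 12 ^ 3 :: 'a fps)"
proof -
  let ?G = "rd_series 3 3 :: 'a fps"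
  have quotient: "?G * \<f> 1 * \<f> 9 = \<f> 3 ^ 2"
    using rd_series_mult_euler_prods[of 3 3, where ?'a = 'a] by (simp add: power2_eq_square)
  have cube: "fps_X * \<f> 9 ^ 3 = (\<f> 1 ^ 3 + \<f> 3 :: 'a fps)"
    using euler_prod_1_cube minus_CHAR_2[of "\<f> 1 ^ 3" "\<f> 3 :: 'a fps"] CHAR_2 by simp
  have "\<f> 4 * \<f> 36 * (fps_X * ?G) = (?G * \<f> 1 * \<f> 9) * \<f> 1 ^ 3 * (fps_X * \<f> 9 ^ 3)"
    using euler_prod_quadruple[of 1] euler_prod_quadruple[of 9]
    by (simp add: power4_eq_xxxx power3_eq_cube mult_ac)
  also have "\<dots> = (\<f> 1 ^ 3) ^ 2 * \<f> 3 ^ 2 + \<f> 1 ^ 3 * \<f> 3 ^ 3"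
    unfolding quotient cube by (simp only: power2_eq_square power3_eq_cube distrib_left ac_simps)
  also have "(\<f> 1 ^ 3) ^ 2 * \<f> 3 ^ 2 = (\<f> 4 * \<f> 2 * \<f> 6 :: 'a fps)"
    using euler_prod_double[of 1] euler_prod_quadruple[of 1] euler_prod_double[of 3]
    by (simp flip: power_mult power_add)
  finally show ?thesis
    unfolding euler_prod_cubes_1_3 by (simp only: add.assoc)
qed

lemma residue_part_rd_series_3_3: "residue_part 4 2 (rd_series 3 3) = (0 :: 'a fps)"
proof -
  have supports: "supported_on 4 (\<f> 4 * \<f> 36 :: 'a fps)" "supported_on 4 (\<f> 12 ^ 3 :: 'a fps)"
    "supported_on 2 (\<f> 4 * \<f> 2 * \<f> 6 :: 'a fps)" "supported_on 2 (\<f> 4 ^ 3 :: 'a fps)"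
    by (intro supported_on_mult supported_on_power supported_on_euler_prod; simp)+
  have "\<f> 4 * \<f> 36 * (fps_X * residue_part 4 2 (rd_series 3 3)) =
      residue_part 4 3 (\<f> 4 * \<f> 2 * \<f> 6 + \<f> 4 ^ 3 + fps_X * \<f> 12 ^ 3 :: 'a fps)"
    using residue_part_X_mult[of 2 4 "rd_series 3 3 :: 'a fps"]
      residue_part_mult[OF supports(1), of 3 "fps_X * rd_series 3 3"]
    by (simp add: rd_series_3_3_dissection)
  also have "\<dots> = fps_X * residue_part 4 2 (\<f> 12 ^ 3)"
    using residue_part_X_mult[of 2 4 "\<f> 12 ^ 3 :: 'a fps"]
      residue_part_eq_0[OF supports(3), of 4 3] residue_part_eq_0[OF supports(4), of 4 3]
    by (simp add: residue_part_add)
  also have "\<dots> = 0"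
    using residue_part_eq_0[OF supports(2), of 4 2] by simp
  finally show ?thesis
    using qpoch_nonzero[of _ _ "1 :: 'a"] by simp
qed

lemma of_nat_p_RD_2_5_odd:
  assumes "odd n"
  shows "(of_nat (p_RD 2 5 n) :: 'a) = (if 4 dvd n - 1 then fps_nth (\<f> 5) ((n - 1) div 4) else 0)"
proof -
  have "of_nat (p_RD 2 5 n) = fps_nth (residue_part 2 1 (rd_series 2 5) :: 'a fps) n"
    using assms by (simp add: residue_part_def rd_series_def odd_iff_mod_2_eq_one)
  also have "\<dots> = fps_nth (\<f> 5 oo fps_X ^ 4) (n - 1)"
    unfolding residue_part_rd_series_2_5
    using odd_pos[OF assms] euler_prod_compose_X_power[of 5 4] by simp
  finally show ?thesis
    by (simp only: fps_nth_compose_X_power)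
qed

lemma of_nat_p_RD_3_3_eq_0: "(of_nat (p_RD 3 3 (4 * n + 2)) :: 'a) = 0"
proof -
  have "(4 * n + 2) mod 4 = 2" by presburger
  hence "of_nat (p_RD 3 3 (4 * n + 2)) =
      fps_nth (residue_part 4 2 (rd_series 3 3) :: 'a fps) (4 * n + 2)"
    by (simp add: residue_part_def rd_series_def)
  thus ?thesis
    by (simp add: residue_part_rd_series_3_3)
qed

end

lemma of_int_fps_nth_prod:
  fixes f :: "'b \<Rightarrow> int fps" and g :: "'b \<Rightarrow> 'a::comm_ring_1 fps"
  assumes "\<And>i n. of_int (fps_nth (f i) n) = fps_nth (g i) n"
  shows "of_int (fps_nth (\<Prod>i\<in>I. f i) n) = fps_nth (\<Prod>i\<in>I. g i) n"
proof (induction I arbitrary: n rule: infinite_finite_induct)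
  case (insert i I)
  thus ?case by (simp add: fps_mult_nth assms)
qed auto

lemma of_int_fps_nth_qpoch:
  assumes "a > 0" "d > 0"
  shows "of_int (fps_nth (qpoch c a d) n) = fps_nth (qpoch (of_int c) a d :: 'a::idom fps) n"
  unfolding qpoch_def using assms
  by (simp only: fps_nth_prodinf[OF fps_multipliable_one_minus_X_power lessI],
      intro of_int_fps_nth_prod) simp

lemma CHAR_bit: "CHAR(bit) = 2"
  by (rule CHAR_eq_posI) (auto simp: less_2_cases_iff)

theorem theorem4:
  shows "(\<forall>n::nat. [p_RD 3 3 (4 * n + 2) = 0] (mod 2)) \<and>
         (\<forall>n::nat. [p_RD 2 5 (4 * n + 3) = 0] (mod 2)) \<and>
         (\<forall>n::nat. [fps_nth (Abs_fps (\<lambda>n. int (p_RD 2 5 (4 * n + 1)))) n =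
                     fps_nth (\<Prod>m. 1 - fps_X ^ (5 * (m + 1)) :: int fps) n] (mod 2))"
proof (intro conjI allI)
  fix n :: nat
  have nat_cong_0: "[m = 0] (mod 2)" if "of_nat m = (0 :: bit)" for m
    using that of_nat_eq_iff_cong_CHAR[of m 0, where ?'a = bit] by (simp add: CHAR_bit)
  show "[p_RD 3 3 (4 * n + 2) = 0] (mod 2)"
    by (rule nat_cong_0) (rule of_nat_p_RD_3_3_eq_0[OF CHAR_bit])
  have "\<not> 4 dvd 4 * n + 2" by presburger
  thus "[p_RD 2 5 (4 * n + 3) = 0] (mod 2)"
    by (intro nat_cong_0) (simp add: of_nat_p_RD_2_5_odd[OF CHAR_bit])
  have "of_int (int (p_RD 2 5 (4 * n + 1))) = fps_nth (\<f> 5 :: bit fps) n"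
    using of_nat_p_RD_2_5_odd[OF CHAR_bit, of "4 * n + 1"] by simp
  also have "\<dots> = of_int (fps_nth (\<f> 5) n)"
    using of_int_fps_nth_qpoch[of 5 5 1 n, where ?'a = bit] by simp
  finally show "[fps_nth (Abs_fps (\<lambda>n. int (p_RD 2 5 (4 * n + 1)))) n =
      fps_nth (\<Prod>m. 1 - fps_X ^ (5 * (m + 1)) :: int fps) n] (mod 2)"
    unfolding of_int_eq_iff_cong_CHAR by (simp add: CHAR_bit euler_prod_eq_prodinf)
qed

end
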